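(* Let $\pi$ be a permutation of $\{1,\dots,n\}$, let $a=(a_{i,j})$ be the monotone triangle corresponding to $\pi$, and let $1\le i\le n-1$. Assume that $\pi$ contains no 312 pattern at any position less than $i$. Then $\pi$ contains the pattern 312 at position $i$ if and only if there exists a gap in $a$ at row $i$.
   Context: A permutation $\pi=(\pi_1,\dots,\pi_n)$ of $\{1,\dots,n\}$ contains the 312 pattern at position $i$ if there is $k>i+1$ (with $k\le n$) such that $\pi_i>\pi_k>\pi_{i+1}$. The monotone triangle corresponding to $\pi$ is the triangular array $(a_{i,j})_{n\ge i\ge j\ge 1}$ whose $i$-th row $(a_{i,1},\dots,a_{i,i})$ is the list of the first $i$ elements $\pi_1,\dots,\pi_i$ written in increasing order. It contains a gap at position $(i,j)$ (where $1\le j\le i<n$) if $a_{i,j}-a_{i+1,j}>1$; it has a gap at row $i$ if it contains a gap at position $(i,j)$ for some $j$. *)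

theory Defs
  imports Main "HOL-Combinatorics.Permutations"
begin

text \<open>A permutation of \<open>{1..n}\<close> is a function \<open>p\<close> with \<open>p permutes {1..n}\<close>; its one-line
  notation is \<open>(p 1, ..., p n)\<close>. All positions and indices are 1-based.\<close>

definition contains_312_at :: "nat \<Rightarrow> (nat \<Rightarrow> nat) \<Rightarrow> nat \<Rightarrow> bool" where
  "contains_312_at n p i \<longleftrightarrow>
     1 \<le> i \<and> (\<exists>k. i + 1 < k \<and> k \<le> n \<and> p i > p k \<and> p k > p (i + 1))"

text \<open>Only the entries with \<open>1 \<le> j \<le> i \<le> n\<close> are meaningful; \<open>!\<close> is 0-based, hence the shift.\<close>

definition monotone_triangle :: "(nat \<Rightarrow> nat) \<Rightarrow> nat \<Rightarrow> nat \<Rightarrow> nat" where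
  "monotone_triangle p i j = sort (map p [1..<i + 1]) ! (j - 1)"

definition has_gap_at :: "nat \<Rightarrow> (nat \<Rightarrow> nat \<Rightarrow> nat) \<Rightarrow> nat \<Rightarrow> nat \<Rightarrow> bool" where
  "has_gap_at n a i j \<longleftrightarrow>
     1 \<le> j \<and> j \<le> i \<and> i < n \<and> int (a i j) - int (a (i + 1) j) > 1"

definition has_gap_at_row :: "nat \<Rightarrow> (nat \<Rightarrow> nat \<Rightarrow> nat) \<Rightarrow> nat \<Rightarrow> bool" where
  "has_gap_at_row n a i \<longleftrightarrow> (\<exists>j. has_gap_at n a i j)"

end

theory Submission
  imports Defs
begin

text \<open>Write \<open>x = p (i + 1)\<close>. Row \<open>i + 1\<close> of the triangle is row \<open>i\<close> with \<open>x\<close> inserted in order.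
  Below \<open>x\<close> the two rows agree; from \<open>x\<close> on, the difference in a column is the difference of two
  consecutive entries of row \<open>i + 1\<close>. Hence a gap at row \<open>i\<close> says exactly that some value \<open>v > x\<close>
  is missing from row \<open>i + 1\<close> although row \<open>i\<close> has an entry above \<open>v\<close>
  (\<open>gap_insort_iff\<close>). A missing value is \<open>p k\<close> for some \<open>k > i + 1\<close>, so a gap is a 312 pattern whose
  "3" may sit at any position up to \<open>i\<close> (\<open>has_gap_at_row_iff\<close>).

  A 312 pattern at position \<open>i\<close> is the special case where the "3" is at \<open>i\<close>. Conversely, given
  \<open>v = p k\<close> and a position \<open>m < i\<close> with \<open>p m > v\<close>, also \<open>p (m + 1) > v\<close>: otherwise
  \<open>p (m + 1) < v < p m\<close> is a 312 pattern at \<open>m\<close>, which the hypothesis excludes. Hence \<open>p i > v\<close>.\<close>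

text \<open>Shifting a sorted list by one place compares neighbours, and two neighbours differ by more
  than one exactly when a value strictly between them is skipped.\<close>

lemma consecutive_gap_iff:
  fixes x :: nat
  assumes "sorted (x # xs)" "distinct (x # xs)"
  shows "(\<exists>j<length xs. Suc ((x # xs) ! j) < xs ! j) \<longleftrightarrow>
    (\<exists>v. x < v \<and> v \<notin> set xs \<and> (\<exists>y\<in>set xs. v < y))"
  using assms
proof (induction xs arbitrary: x)
  case Nil
  then show ?case by simp
next
  case (Cons b xs)
  have IH: "(\<exists>j<length xs. Suc ((b # xs) ! j) < xs ! j) \<longleftrightarrow>
    (\<exists>v. b < v \<and> v \<notin> set xs \<and> (\<exists>y\<in>set xs. v < y))"
    using Cons.prems by (intro Cons.IH) auto
  have xb: "x < b" and bxs: "\<forall>y\<in>set xs. b < y"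
    using Cons.prems by (auto simp: order_less_le)
  have split: "(\<exists>j<length (b # xs). Suc ((x # b # xs) ! j) < (b # xs) ! j) \<longleftrightarrow>
    Suc x < b \<or> (\<exists>j<length xs. Suc ((b # xs) ! j) < xs ! j)"
    by (simp add: Ex_less_Suc2)
  show ?case
  proof (cases "Suc x < b")
    case True
    then have "x < Suc x \<and> Suc x \<notin> set (b # xs) \<and> (\<exists>y\<in>set (b # xs). Suc x < y)"
      using bxs by fastforce
    then show ?thesis using True split by blast
  next
    case False
    then have "b = Suc x" using xb by simp
    then have "(\<exists>v. x < v \<and> v \<notin> set (b # xs) \<and> (\<exists>y\<in>set (b # xs). v < y)) \<longleftrightarrow>
      (\<exists>v. b < v \<and> v \<notin> set xs \<and> (\<exists>y\<in>set xs. v < y))"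
      using bxs by (intro ex_cong1) (auto dest: Suc_lessI)
    then show ?thesis using split IH False by simp
  qed
qed

text \<open>The entries below \<open>x\<close> keep their places and produce no gap; the remaining tail of the list is
  compared with its own shift by \<open>x\<close>.\<close>

lemma gap_insort_iff:
  fixes x :: nat
  assumes "sorted xs" "distinct xs" "x \<notin> set xs"
  shows "(\<exists>j<length xs. Suc (insort x xs ! j) < xs ! j) \<longleftrightarrow>
    (\<exists>v. x < v \<and> v \<notin> set xs \<and> (\<exists>y\<in>set xs. v < y))"
  using assms
proof (induction xs)
  case Nil
  then show ?case by simp
next
  case (Cons b xs)
  show ?case
  proof (cases "x < b")
    case True
    then have "sorted (x # b # xs)" "distinct (x # b # xs)"
      using Cons.prems by auto
    from consecutive_gap_iff[OF this] True show ?thesis by simp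
  next
    case False
    then have "b < x" using Cons.prems by simp
    have IH: "(\<exists>j<length xs. Suc (insort x xs ! j) < xs ! j) \<longleftrightarrow>
      (\<exists>v. x < v \<and> v \<notin> set xs \<and> (\<exists>y\<in>set xs. v < y))"
      using Cons.prems by (intro Cons.IH) auto
    have "(\<exists>j<length (b # xs). Suc (insort x (b # xs) ! j) < (b # xs) ! j) \<longleftrightarrow>
      (\<exists>j<length xs. Suc (insort x xs ! j) < xs ! j)"
      using False \<open>b < x\<close> by (simp add: Ex_less_Suc2)
    also have "\<dots> \<longleftrightarrow> (\<exists>v. x < v \<and> v \<notin> set (b # xs) \<and> (\<exists>y\<in>set (b # xs). v < y))"
      unfolding IH using \<open>b < x\<close> by (intro ex_cong1) auto
    finally show ?thesis .
  qed
qed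

lemma sort_snoc: "sort (xs @ [x]) = insort x (sort xs)"
  by (rule properties_for_sort) (simp_all add: sorted_insort)

text \<open>This holds for every permutation: the sorted row forgets the order of the first \<open>i\<close> entries,
  which is why the largest entry \<open>p m\<close> of the pattern need not be adjacent to \<open>p (i + 1)\<close>.\<close>

lemma has_gap_at_row_iff:
  assumes p: "p permutes {1..n}" and "i < n"
  shows "has_gap_at_row n (monotone_triangle p) i \<longleftrightarrow>
    (\<exists>k m. i + 1 < k \<and> k \<le> n \<and> 1 \<le> m \<and> m \<le> i \<and> p (i + 1) < p k \<and> p k < p m)"
    (is "_ \<longleftrightarrow> ?R")
proof -
  define xs where "xs = sort (map p [1..<i + 1])"
  define x where "x = p (i + 1)"
  have inj: "p r = p s \<longleftrightarrow> r = s" for r s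
    by (rule inj_eq[OF permutes_inj[OF p]])
  have set_xs: "set xs = p ` {1..i}"
    by (simp add: xs_def atLeastLessThanSuc_atLeastAtMost del: upt_Suc)
  have len: "length xs = i" by (simp add: xs_def)
  have "sorted xs" "distinct xs" "x \<notin> set xs"
    by (auto simp: xs_def x_def inj distinct_map inj_on_def)
  note gap = gap_insort_iff[OF this]
  have row: "monotone_triangle p i j = xs ! (j - 1)" for j
    by (simp add: monotone_triangle_def xs_def)
  have next_row: "monotone_triangle p (i + 1) j = insort x xs ! (j - 1)" for j
    using sort_snoc[of "map p [1..<i + 1]" "p (i + 1)"]
    by (simp add: monotone_triangle_def xs_def x_def)
  have "has_gap_at_row n (monotone_triangle p) i \<longleftrightarrow>
    (\<exists>j. 1 \<le> j \<and> j \<le> i \<and> Suc (insort x xs ! (j - 1)) < xs ! (j - 1))"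
    using \<open>i < n\<close> unfolding has_gap_at_row_def has_gap_at_def row next_row
    by (intro ex_cong1 conj_cong) auto
  also have "\<dots> \<longleftrightarrow> (\<exists>j<length xs. Suc (insort x xs ! j) < xs ! j)"
  proof
    assume "\<exists>j. 1 \<le> j \<and> j \<le> i \<and> Suc (insort x xs ! (j - 1)) < xs ! (j - 1)"
    then obtain j where "1 \<le> j" "j \<le> i" "Suc (insort x xs ! (j - 1)) < xs ! (j - 1)" by blast
    then show "\<exists>j<length xs. Suc (insort x xs ! j) < xs ! j"
      by (intro exI[of _ "j - 1"]) (auto simp: len)
  next
    assume "\<exists>j<length xs. Suc (insort x xs ! j) < xs ! j"
    then obtain j where "j < i" "Suc (insort x xs ! j) < xs ! j" by (auto simp: len)
    then show "\<exists>j. 1 \<le> j \<and> j \<le> i \<and> Suc (insort x xs ! (j - 1)) < xs ! (j - 1)"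
      by (intro exI[of _ "Suc j"]) auto
  qed
  also have "\<dots> \<longleftrightarrow> ?R"
    unfolding gap
  proof
    assume "\<exists>v>x. v \<notin> set xs \<and> (\<exists>y\<in>set xs. v < y)"
    then obtain v m where v: "x < v" "v \<notin> set xs" and m: "1 \<le> m" "m \<le> i" "v < p m"
      by (auto simp: set_xs)
    \<comment> \<open>From \<open>0 \<le> x < v < p m \<le> n\<close>, the skipped value is one of the permuted numbers.\<close>
    have "p m \<in> {1..n}"
      using m \<open>i < n\<close> permutes_in_image[OF p, of m] by simp
    with v m have "v \<in> p ` {1..n}"
      using permutes_image[OF p] by simp
    then obtain k where k: "v = p k" "1 \<le> k" "k \<le> n" by auto
    have "\<not> k \<le> i" using v(2) k by (auto simp: set_xs)
    moreover have "k \<noteq> i + 1" using v(1) k by (auto simp: x_def)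
    ultimately have "i + 1 < k" by simp
    then show ?R using k v m x_def by blast
  next
    assume ?R
    then obtain k m where km: "i + 1 < k" "1 \<le> m" "m \<le> i" "x < p k" "p k < p m"
      by (auto simp: x_def)
    then have "p k \<notin> set xs" "p m \<in> set xs" by (auto simp: set_xs inj)
    with km show "\<exists>v>x. v \<notin> set xs \<and> (\<exists>y\<in>set xs. v < y)" by blast
  qed
  finally show ?thesis .
qed

theorem lemma2:
  fixes n i :: nat and p :: "nat \<Rightarrow> nat" and a :: "nat \<Rightarrow> nat \<Rightarrow> nat"
  assumes "p permutes {1..n}"
    and "a = monotone_triangle p"
    and "1 \<le> i" and "i \<le> n - 1"
    and "\<And>m. 1 \<le> m \<Longrightarrow> m < i \<Longrightarrow> \<not> contains_312_at n p m"
  shows "contains_312_at n p i \<longleftrightarrow> has_gap_at_row n a i"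
proof -
  have "i < n" using assms(3,4) by simp
  note gap = has_gap_at_row_iff[OF assms(1) this, folded assms(2)]
  show ?thesis
  proof
    assume "contains_312_at n p i"
    then show "has_gap_at_row n a i"
      unfolding gap contains_312_at_def by blast
  next
    assume "has_gap_at_row n a i"
    then obtain k m where k: "i + 1 < k" "k \<le> n" "p (i + 1) < p k"
      and m: "1 \<le> m" "m \<le> i" "p k < p m"
      unfolding gap by blast
    have "p k < p i"
      using m(2,1,3)
    proof (induction m rule: inc_induct)
      case base
      then show ?case by simp
    next
      case (step m)
      have "\<not> p (Suc m) < p k"
        using assms(5)[of m] step.hyps step.prems k by (auto simp: contains_312_at_def)
      moreover have "p (Suc m) \<noteq> p k"
        using inj_eq[OF permutes_inj[OF assms(1)], of "Suc m" k] step.hyps k(1) by simp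
      ultimately show ?case using step.IH by simp
    qed
    with k assms(3) show "contains_312_at n p i"
      unfolding contains_312_at_def by blast
  qed
qed

end
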